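(* Let $X$ be a separable real Hilbert space and suppose $$\mu=\mathrm{Law}\left\{u=\sum_{k=1}^\infty\gamma_k\xi_k r_k\right\}\in P(X),$$ where $\{r_k\}_{k=1}^\infty$ is an orthonormal basis of $X$, $\{\xi_k\}_{k=1}^\infty$ are independent random variables with laws $\mu_k\in P(\mathbb{R})$, and $\{\gamma_k\}_{k=1}^\infty$ is a fixed sequence in $\mathbb{R}$ that decays sufficiently fast so that $\|u\|_X<+\infty$ a.s. and $\mu$ is well-defined. Suppose that for each $k$, $\mathcal{Q}_k$ is a probability kernel on $\mathbb{R}$ that is $\mu_k$-reversible, and let $\mathcal{Q}(u,dv)$ be the transition kernel corresponding to the following operations: 1. For $k=1,2,3,\dots$ draw $\zeta_k\sim\mathcal{Q}_k(\xi_k,d\zeta_k)$, independently over $k$, where $\xi_k$ are the coefficients in the expansion $u=\sum_{k=1}^\infty\gamma_k\xi_kr_k$. 2. Set $v=\sum_{k=1}^\infty\gamma_k\zeta_kr_k$. Then $\mathcal{Q}$ satisfies detailed balance with respect to $\mu$.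
   Context: $P(X)$ and $P(\mathbb{R})$ denote the Radon probability measures on $X$ and $\mathbb{R}$. A probability kernel on a space $Y$ (here $Y=X$ or $Y=\mathbb{R}$) is a map $\mathcal{Q}:Y\times\mathcal{B}(Y)\to[0,1]$ such that $\mathcal{Q}(\cdot,A)$ is measurable for every Borel set $A$ and $\mathcal{Q}(u,\cdot)$ is a probability measure for every $u\in Y$. A probability kernel $\mathcal{Q}$ is reversible with respect to (equivalently, satisfies detailed balance with respect to) a probability measure $\mu$ if $\mathcal{Q}(u,dv)\,d\mu(u)=\mathcal{Q}(v,du)\,d\mu(v)$ as measures on $Y\times Y$, i.e. $\int_A\mathcal{Q}(u,B)\,d\mu(u)=\int_B\mathcal{Q}(u,A)\,d\mu(u)$ for all Borel $A,B$. The kernel $\mathcal{Q}(u,dv)$ on $X$ in the claim is understood for $\mu$-a.e. $u$; indices $k$ with $\gamma_k=0$ contribute nothing to $u$ or $v$. *)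

theory Defs
  imports "HOL-Probability.Probability"
begin

definition orthonormal_basis :: "(nat \<Rightarrow> 'a::real_inner) \<Rightarrow> bool" where
  "orthonormal_basis r \<longleftrightarrow>
     (\<forall>i j. r i \<bullet> r j = (if i = j then 1 else 0)) \<and> closure (span (range r)) = UNIV"

(* Measurability into prob_algebra borel says that each K u is a Borel probability measure
   and that u \<mapsto> K u A is measurable for every Borel set A. *)
definition prob_kernel :: "('a::topological_space \<Rightarrow> 'a measure) \<Rightarrow> bool" where
  "prob_kernel K \<longleftrightarrow> K \<in> borel \<rightarrow>\<^sub>M prob_algebra borel"

definition detailed_balance ::
    "'a::topological_space measure \<Rightarrow> ('a \<Rightarrow> 'a measure) \<Rightarrow> bool" where
  "detailed_balance \<mu> K \<longleftrightarrow>
     (\<forall>A\<in>sets borel. \<forall>B\<in>sets borel.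
        (\<integral>\<^sup>+u\<in>A. emeasure (K u) B \<partial>\<mu>) = (\<integral>\<^sup>+u\<in>B. emeasure (K u) A \<partial>\<mu>))"

definition series_term ::
    "(nat \<Rightarrow> real) \<Rightarrow> (nat \<Rightarrow> 'a::real_inner) \<Rightarrow> (nat \<Rightarrow> real) \<Rightarrow> nat \<Rightarrow> 'a" where
  "series_term \<gamma> r c k = (\<gamma> k * c k) *\<^sub>R r k"

(* Where \<gamma> k = 0, the k-th coefficient is not determined by u; division by zero then
   sets it to 0. This choice is immaterial, as the k-th term of either series vanishes. *)
definition coefficient ::
    "(nat \<Rightarrow> real) \<Rightarrow> (nat \<Rightarrow> 'a::real_inner) \<Rightarrow> 'a \<Rightarrow> nat \<Rightarrow> real" where
  "coefficient \<gamma> r u k = (u \<bullet> r k) / \<gamma> k"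

lemma coefficient_unique:
  assumes r: "orthonormal_basis r"
    and u: "series_term \<gamma> r c sums u"
    and k: "\<gamma> k \<noteq> 0"
  shows "coefficient \<gamma> r u k = c k"
proof -
  have "(\<lambda>n. series_term \<gamma> r c n \<bullet> r k) sums (u \<bullet> r k)"
    using bounded_linear.sums[OF bounded_linear_inner_left u] .
  moreover have "(\<lambda>n. series_term \<gamma> r c n \<bullet> r k) = (\<lambda>n. if n = k then \<gamma> k * c k else 0)"
    using r by (auto simp: orthonormal_basis_def series_term_def)
  moreover have "(\<lambda>n. if n = k then \<gamma> k * c k else 0) sums (\<gamma> k * c k)"
    using sums_single[of k "\<lambda>_. \<gamma> k * c k"] .
  ultimately have "u \<bullet> r k = \<gamma> k * c k"
    using sums_unique2 by metis
  then show ?thesis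
    using k by (simp add: coefficient_def)
qed

definition draw_law ::
    "(nat \<Rightarrow> real) \<Rightarrow> (nat \<Rightarrow> 'a::real_inner) \<Rightarrow> (nat \<Rightarrow> real \<Rightarrow> real measure) \<Rightarrow> 'a
      \<Rightarrow> (nat \<Rightarrow> real) measure" where
  "draw_law \<gamma> r Qs u = (\<Pi>\<^sub>M k\<in>UNIV. Qs k (coefficient \<gamma> r u k))"

(* Where the series diverges, suminf takes a fixed value, so this is defined for every u; it is the
   law of the series only for those u for which the series converges almost surely. *)
definition product_kernel ::
    "(nat \<Rightarrow> real) \<Rightarrow> (nat \<Rightarrow> 'a::real_inner) \<Rightarrow> (nat \<Rightarrow> real \<Rightarrow> real measure) \<Rightarrow> 'a
      \<Rightarrow> 'a measure" where
  "product_kernel \<gamma> r Qs u =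
     distr (draw_law \<gamma> r Qs u) borel (\<lambda>\<zeta>. \<Sum>k. series_term \<gamma> r \<zeta> k)"

end

(* Let T send a sequence c to the product of the laws Q_k(c_k). On pairs of cylinders, detailed
   balance of T with respect to the law P of the sequence xi factorises by independence into
   detailed balance of finitely many Q_k; uniqueness of measures, applied to one cylinder at a time,
   gives it on all measurable sets. The theorem is the image of this under c |-> S(c), the sum of
   the series, since c can be recovered from S(c) in every coordinate that S depends on. Detailed
   balance against the whole space says that T preserves P, so the drawn series converges almost
   surely because the original one does. *)
theory Submission
  imports Defs
begin

section \<open>Cylinder sets in infinite products\<close>

lemma prod_emb_UNIV_PiE:
  "prod_emb UNIV M J (Pi\<^sub>E J A) = {f. (\<forall>i\<in>J. f i \<in> A i) \<and> (\<forall>i. f i \<in> space (M i))}"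
  by (auto simp: prod_emb_iff PiE_iff)

lemma cylinder_measurable:
  assumes "finite J" "\<And>i. i \<in> J \<Longrightarrow> A i \<in> sets (M i)" "\<And>i. space (M i) = UNIV"
  shows "{f. \<forall>i\<in>J. f i \<in> A i} \<in> sets (Pi\<^sub>M UNIV M)"
  using sets_PiM_I[of J UNIV A M] assms by (simp add: prod_emb_UNIV_PiE)

lemma emeasure_PiM_cylinder:
  assumes "\<And>i. prob_space (M i)" "\<And>i. space (M i) = UNIV"
    and "finite J" "\<And>i. i \<in> J \<Longrightarrow> A i \<in> sets (M i)"
  shows "emeasure (Pi\<^sub>M UNIV M) {f. \<forall>i\<in>J. f i \<in> A i} = (\<Prod>i\<in>J. emeasure (M i) (A i))"
  using emeasure_PiM_emb[of UNIV M J A] assms by (simp add: prod_emb_UNIV_PiE)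

text \<open>Cylinders form a generator stable under intersection, and \<open>J = {}\<close> gives
  the whole space, which has finite \<open>P\<close>-measure; so the uniqueness theorem for measures
  applies.\<close>

lemma measure_eqI_cylinder:
  assumes "sets P = sets (Pi\<^sub>M UNIV M)" "sets Q = sets (Pi\<^sub>M UNIV M)" "finite_measure P"
    and "\<And>i. space (M i) = UNIV"
    and "\<And>J A. finite J \<Longrightarrow> (\<And>i. i \<in> J \<Longrightarrow> A i \<in> sets (M i)) \<Longrightarrow>
      emeasure P {f. \<forall>i\<in>J. f i \<in> A i} = emeasure Q {f. \<forall>i\<in>J. f i \<in> A i}"
  shows "P = Q"
  by (rule measure_eqI_PiM_infinite[OF assms(1,2) _ assms(3)]) (simp add: prod_emb_UNIV_PiE assms(4,5))

section \<open>Kernels and their products\<close>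

lemma prob_kernelD:
  assumes "prob_kernel K"
  shows "prob_space (K x)" "sets (K x) = sets borel" "space (K x) = UNIV"
  using measurable_space[of K borel "prob_algebra borel" x] assms sets_eq_imp_space_eq[of "K x" borel]
  by (auto simp: prob_kernel_def space_prob_algebra)

text \<open>Measurability has to be tested only on the cylinder generator. There the mass is a
  finite product of kernel values, each a measurable function of a single coordinate of
  \<open>c\<close>.\<close>

lemma measurable_PiM_kernel:
  fixes Q :: "'i \<Rightarrow> 'b::topological_space \<Rightarrow> 'b measure"
  assumes Q: "\<And>i. prob_kernel (Q i)"
  shows "(\<lambda>c. \<Pi>\<^sub>M i\<in>UNIV. Q i (c i)) \<in> Pi\<^sub>M UNIV (\<lambda>_. borel) \<rightarrow>\<^sub>M prob_algebra (Pi\<^sub>M UNIV (\<lambda>_. borel))"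
proof (rule measurable_prob_algebra_generated[OF sets_PiM Int_stable_prod_algebra prod_algebra_sets_into_space])
  fix c :: "'i \<Rightarrow> 'b"
  show "prob_space (\<Pi>\<^sub>M i\<in>UNIV. Q i (c i))"
    by (intro prob_space_PiM prob_kernelD Q)
  show "sets (\<Pi>\<^sub>M i\<in>UNIV. Q i (c i)) = sets (Pi\<^sub>M UNIV (\<lambda>_. borel))"
    by (intro sets_PiM_cong refl prob_kernelD Q)
next
  fix Z assume "Z \<in> prod_algebra UNIV (\<lambda>_::'i. borel::'b measure)"
  then obtain J A where Z: "Z = {f. \<forall>i\<in>J. f i \<in> A i}" and J: "finite J"
    and A: "\<And>i. i \<in> J \<Longrightarrow> A i \<in> sets borel"
    by (elim prod_algebraE) (auto simp: prod_emb_UNIV_PiE)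
  have "emeasure (\<Pi>\<^sub>M i\<in>UNIV. Q i (c i)) Z = (\<Prod>i\<in>J. emeasure (Q i (c i)) (A i))" for c
    unfolding Z by (rule emeasure_PiM_cylinder) (auto simp: prob_kernelD[OF Q] J A)
  moreover have "(\<lambda>x. emeasure (Q i x) (A i)) \<in> borel_measurable borel" if "i \<in> J" for i
    by (rule measurable_emeasure_kernel[OF measurable_prob_algebraD])
      (use Q A[OF that] in \<open>auto simp: prob_kernel_def\<close>)
  ultimately show "(\<lambda>c. emeasure (\<Pi>\<^sub>M i\<in>UNIV. Q i (c i)) Z) \<in> borel_measurable (Pi\<^sub>M UNIV (\<lambda>_. borel))"
    by (auto intro!: borel_measurable_prod_ennreal measurable_compose[OF measurable_component_singleton])
qed

section \<open>Detailed balance on the sequence space\<close>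

text \<open>With a common finite base \<open>J\<close> the integrand is a product over
  \<open>J\<close> of functions of one \<open>X i\<close> each. Independence makes the integral a
  product of integrals, and each factor is symmetric in \<open>A i\<close> and \<open>B i\<close> by
  the balance of \<open>Q i\<close>.\<close>

lemma PiM_kernel_balance_cylinder:
  fixes Q :: "'i \<Rightarrow> 'b::topological_space \<Rightarrow> 'b measure" and X :: "'i \<Rightarrow> 'w \<Rightarrow> 'b"
  assumes M: "prob_space M"
    and X: "prob_space.indep_vars M (\<lambda>_. borel) X UNIV"
    and Q: "\<And>i. prob_kernel (Q i)"
    and bal: "\<And>i. detailed_balance (distr M borel (X i)) (Q i)"
    and J: "finite J" and A: "\<And>i. A i \<in> sets borel" and B: "\<And>i. B i \<in> sets borel"
  defines "T \<equiv> \<lambda>c. \<Pi>\<^sub>M i\<in>UNIV. Q i (c i)"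
  shows "(\<integral>\<^sup>+\<omega>. emeasure (T (\<lambda>i. X i \<omega>)) {f. \<forall>i\<in>J. f i \<in> B i} * indicator {f. \<forall>i\<in>J. f i \<in> A i} (\<lambda>i. X i \<omega>) \<partial>M)
       = (\<integral>\<^sup>+\<omega>. emeasure (T (\<lambda>i. X i \<omega>)) {f. \<forall>i\<in>J. f i \<in> A i} * indicator {f. \<forall>i\<in>J. f i \<in> B i} (\<lambda>i. X i \<omega>) \<partial>M)"
proof -
  interpret prob_space M by fact
  have meas: "random_variable borel (X i)" for i
    using X by (auto simp: indep_vars_def)
  have factor: "(\<integral>\<^sup>+\<omega>. emeasure (T (\<lambda>i. X i \<omega>)) {f. \<forall>i\<in>J. f i \<in> B i} * indicator {f. \<forall>i\<in>J. f i \<in> A i} (\<lambda>i. X i \<omega>) \<partial>M)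
      = (\<Prod>i\<in>J. \<integral>\<^sup>+x\<in>A i. emeasure (Q i x) (B i) \<partial>distr M borel (X i))"
    if A: "\<And>i. A i \<in> sets borel" and B: "\<And>i. B i \<in> sets borel" for A B :: "'i \<Rightarrow> 'b set"
  proof -
    \<comment> \<open>The part of the integrand that sees only coordinate \<open>i\<close>: start in
      \<open>A i\<close>, then move into \<open>B i\<close>.\<close>
    define g where "g i x = emeasure (Q i x) (B i) * indicator (A i) x" for i x
    have g [measurable]: "g i \<in> borel_measurable borel" for i
      unfolding g_def using A B Q
      by (intro borel_measurable_times_ennreal measurable_emeasure_kernel[OF measurable_prob_algebraD])
        (auto simp: prob_kernel_def)
    have "emeasure (T c) {f. \<forall>i\<in>J. f i \<in> B i} = (\<Prod>i\<in>J. emeasure (Q i (c i)) (B i))" for c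
      unfolding T_def by (rule emeasure_PiM_cylinder) (auto simp: prob_kernelD[OF Q] J B)
    moreover have "indicator {f. \<forall>i\<in>J. f i \<in> A i} c = (\<Prod>i\<in>J. indicator (A i) (c i) :: ennreal)" for c
      using J by (induction J rule: finite_induct) (auto simp: indicator_def)
    ultimately have "(\<integral>\<^sup>+\<omega>. emeasure (T (\<lambda>i. X i \<omega>)) {f. \<forall>i\<in>J. f i \<in> B i} * indicator {f. \<forall>i\<in>J. f i \<in> A i} (\<lambda>i. X i \<omega>) \<partial>M)
        = (\<integral>\<^sup>+\<omega>. (\<Prod>i\<in>J. g i (X i \<omega>)) \<partial>M)"
      by (simp add: g_def prod.distrib)
    also have "\<dots> = (\<Prod>i\<in>J. \<integral>\<^sup>+\<omega>. g i (X i \<omega>) \<partial>M)"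
      by (rule indep_vars_nn_integral[OF J indep_vars_subset[OF indep_vars_compose2[OF X]]]) auto
    also have "\<dots> = (\<Prod>i\<in>J. \<integral>\<^sup>+x. g i x \<partial>distr M borel (X i))"
      using meas by (simp add: nn_integral_distr)
    finally show ?thesis by (simp add: g_def)
  qed
  show ?thesis
    unfolding factor[OF A B] factor[OF B A]
    using bal A B by (auto simp: detailed_balance_def intro!: prod.cong)
qed

text \<open>For a fixed set \<open>A\<close>, each side is a measure in \<open>B\<close>: the left
  one is \<open>P\<close> restricted to \<open>A\<close> and pushed through \<open>T\<close>, the
  right one has density \<open>emeasure (T c) A\<close> with respect to \<open>P\<close>. The claim
  thus becomes an equality of two measures, decided on cylinders.\<close>

lemma PiM_kernel_balance:
  fixes Q :: "'i \<Rightarrow> 'b::topological_space \<Rightarrow> 'b measure" and X :: "'i \<Rightarrow> 'w \<Rightarrow> 'b"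
  assumes M: "prob_space M"
    and X: "prob_space.indep_vars M (\<lambda>_. borel) X UNIV"
    and Q: "\<And>i. prob_kernel (Q i)"
    and bal: "\<And>i. detailed_balance (distr M borel (X i)) (Q i)"
    and A: "A \<in> sets (Pi\<^sub>M UNIV (\<lambda>_. borel))" and B: "B \<in> sets (Pi\<^sub>M UNIV (\<lambda>_. borel))"
  defines "T \<equiv> \<lambda>c. \<Pi>\<^sub>M i\<in>UNIV. Q i (c i)"
  defines "P \<equiv> distr M (Pi\<^sub>M UNIV (\<lambda>_. borel)) (\<lambda>\<omega> i. X i \<omega>)"
  shows "(\<integral>\<^sup>+c\<in>A. emeasure (T c) B \<partial>P) = (\<integral>\<^sup>+c\<in>B. emeasure (T c) A \<partial>P)"
proof -
  interpret prob_space M by fact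
  let ?N = "Pi\<^sub>M UNIV (\<lambda>_::'i. borel::'b measure)"
  have meas: "random_variable borel (X i)" for i
    using X by (auto simp: indep_vars_def)
  have XN [measurable]: "(\<lambda>\<omega> i. X i \<omega>) \<in> M \<rightarrow>\<^sub>M ?N"
    using measurable_PiM_single'[of UNIV X M "\<lambda>_. borel"] meas by (simp add: PiE_def)
  interpret P: prob_space P
    unfolding P_def by (rule prob_space_distr[OF XN])
  have sets_P [measurable_cong]: "sets P = sets ?N" and space_P: "space P = UNIV"
    by (simp_all add: P_def space_PiM)
  have T: "T \<in> ?N \<rightarrow>\<^sub>M prob_algebra ?N"
    unfolding T_def by (rule measurable_PiM_kernel[OF Q])
  have [measurable]: "T \<in> P \<rightarrow>\<^sub>M subprob_algebra ?N"
    using measurable_prob_algebraD[OF T] by (simp add: measurable_cong_sets[OF sets_P refl])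
  have Tm [measurable]: "(\<lambda>c. emeasure (T c) C) \<in> borel_measurable P" if "C \<in> sets ?N" for C
    by (rule measurable_emeasure_kernel[OF _ that]) measurable
  \<comment> \<open>\<open>bind\<close> and \<open>dens\<close> exhibit the two sides of the balance
    equation as measures in \<open>D\<close> for fixed \<open>C\<close>.\<close>
  have bind: "emeasure (density P (indicator C) \<bind> T) D = (\<integral>\<^sup>+c\<in>C. emeasure (T c) D \<partial>P)"
    if "C \<in> sets ?N" "D \<in> sets ?N" for C D
    using that by (subst emeasure_bind[where N="?N"])
      (auto simp: space_P nn_integral_density mult.commute intro!: measurable_emeasure_kernel)
  have dens: "emeasure (density P (\<lambda>c. emeasure (T c) C)) D = (\<integral>\<^sup>+c\<in>D. emeasure (T c) C \<partial>P)"
    if "C \<in> sets ?N" "D \<in> sets ?N" for C D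
    using that by (intro emeasure_density) auto
  have sets_bind: "sets (density P (indicator C) \<bind> T) = sets ?N" for C
    by (rule sets_bind[where N="?N"]) (auto simp: space_P sets_kernel[OF measurable_prob_algebraD[OF T]] space_PiM)
  have le1: "(\<integral>\<^sup>+c\<in>C. emeasure (T c) D \<partial>P) \<le> 1" if "C \<in> sets ?N" "D \<in> sets ?N" for C D
  proof -
    have "prob_space (T c)" for c
      using measurable_space[OF T, of c] by (auto simp: space_prob_algebra space_PiM)
    then have "(\<integral>\<^sup>+c\<in>C. emeasure (T c) D \<partial>P) \<le> (\<integral>\<^sup>+c. 1 \<partial>P)"
      by (intro nn_integral_mono)
        (auto simp: indicator_def prob_space.emeasure_le_1)
    then show ?thesis by (simp add: P.emeasure_space_1)
  qed
  have fin: "finite_measure (density P (indicator C) \<bind> T)" if "C \<in> sets ?N" for C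
  proof
    have "space (density P (indicator C) \<bind> T) = space ?N"
      by (rule sets_eq_imp_space_eq[OF sets_bind])
    then show "emeasure (density P (indicator C) \<bind> T) (space (density P (indicator C) \<bind> T)) \<noteq> \<infinity>"
      using le1[OF that, of "space ?N"] by (auto simp: bind[OF that] top_unique simp del: space_PiM)
  qed
  \<comment> \<open>Back to the space \<open>M\<close>, on which the independence of the
    \<open>X i\<close> is stated.\<close>
  have PM: "(\<integral>\<^sup>+c\<in>C. emeasure (T c) D \<partial>P) = (\<integral>\<^sup>+\<omega>. emeasure (T (\<lambda>i. X i \<omega>)) D * indicator C (\<lambda>i. X i \<omega>) \<partial>M)"
    if "C \<in> sets ?N" "D \<in> sets ?N" for C D
    using that Tm[of D] unfolding P_def by (subst nn_integral_distr) auto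
  have cyl: "{f. \<forall>i\<in>J. f i \<in> C i} \<in> sets ?N"
    if "finite J" "\<And>i. i \<in> J \<Longrightarrow> C i \<in> sets borel" for J C
    using that by (intro cylinder_measurable) auto
  have balance: "(\<integral>\<^sup>+c\<in>{f. \<forall>i\<in>J. f i \<in> C i}. emeasure (T c) {f. \<forall>i\<in>K. f i \<in> D i} \<partial>P)
      = (\<integral>\<^sup>+c\<in>{f. \<forall>i\<in>K. f i \<in> D i}. emeasure (T c) {f. \<forall>i\<in>J. f i \<in> C i} \<partial>P)"
    if J: "finite J" "\<And>i. i \<in> J \<Longrightarrow> C i \<in> sets borel"
      and K: "finite K" "\<And>i. i \<in> K \<Longrightarrow> D i \<in> sets borel" for J K C D
  proof -
    \<comment> \<open>The two cylinders may have different bases; padding with \<open>UNIV\<close>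
      puts both over \<open>J \<union> K\<close>.\<close>
    let ?C = "\<lambda>i. if i \<in> J then C i else UNIV" and ?D = "\<lambda>i. if i \<in> K then D i else UNIV"
    have cylinders: "{f. \<forall>i\<in>J. f i \<in> C i} = {f. \<forall>i\<in>J \<union> K. f i \<in> ?C i}"
      "{f. \<forall>i\<in>K. f i \<in> D i} = {f. \<forall>i\<in>J \<union> K. f i \<in> ?D i}" by auto
    have sets: "{f. \<forall>i\<in>J \<union> K. f i \<in> ?C i} \<in> sets ?N" "{f. \<forall>i\<in>J \<union> K. f i \<in> ?D i} \<in> sets ?N"
      using that by (intro cyl; auto)+
    have CD: "?C i \<in> sets borel" "?D i \<in> sets borel" for i
      using that by auto
    show ?thesis
      unfolding cylinders PM[OF sets] PM[OF sets(2,1)] unfolding T_def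
      using J(1) K(1) by (intro PiM_kernel_balance_cylinder[OF M X Q bal] CD) auto
  qed
  \<comment> \<open>First extension: one set stays a cylinder, the other becomes arbitrary.\<close>
  have half: "(\<integral>\<^sup>+c\<in>{f. \<forall>i\<in>J. f i \<in> C i}. emeasure (T c) B \<partial>P)
      = (\<integral>\<^sup>+c\<in>B. emeasure (T c) {f. \<forall>i\<in>J. f i \<in> C i} \<partial>P)"
    if J: "finite J" "\<And>i. i \<in> J \<Longrightarrow> C i \<in> sets borel" and B: "B \<in> sets ?N" for J C B
  proof -
    let ?C = "{f. \<forall>i\<in>J. f i \<in> C i}"
    have C: "?C \<in> sets ?N"
      using J by (rule cyl)
    have "density P (indicator ?C) \<bind> T = density P (\<lambda>c. emeasure (T c) ?C)"
      by (rule measure_eqI_cylinder[OF sets_bind _ fin[OF C]])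
        (simp_all add: sets_P bind[OF C] dens[OF C] cyl balance J)
    then show ?thesis
      using bind[OF C B] dens[OF C B] by simp
  qed
  \<comment> \<open>Second extension: with the arbitrary \<open>B\<close> now fixed,
    \<open>half\<close> supplies the agreement on cylinders.\<close>
  have "density P (indicator B) \<bind> T = density P (\<lambda>c. emeasure (T c) B)"
    by (rule measure_eqI_cylinder[OF sets_bind _ fin[OF B]])
      (simp_all add: sets_P bind[OF B] dens[OF B] cyl half[OF _ _ B])
  then show ?thesis
    using bind[OF B A] dens[OF B A] by simp
qed

section \<open>Sets that depend on some coordinates only\<close>

text \<open>Overwriting all coordinates outside \<open>I\<close> by a constant leaves
  \<open>B\<close> invariant, and the image law under this map no longer sees the factors outside
  \<open>I\<close>.\<close>

lemma emeasure_PiM_saturated_cong: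
  fixes K L :: "'i \<Rightarrow> 'b::topological_space measure"
  assumes K: "\<And>i. prob_space (K i)" "\<And>i. sets (K i) = sets borel"
    and L: "\<And>i. prob_space (L i)" "\<And>i. sets (L i) = sets borel"
    and eq: "\<And>i. i \<in> I \<Longrightarrow> K i = L i"
    and B: "B \<in> sets (Pi\<^sub>M UNIV (\<lambda>_. borel))"
    and sat: "\<And>f g. (\<And>i. i \<in> I \<Longrightarrow> f i = g i) \<Longrightarrow> f \<in> B \<longleftrightarrow> g \<in> B"
  shows "emeasure (Pi\<^sub>M UNIV K) B = emeasure (Pi\<^sub>M UNIV L) B"
proof -
  let ?N = "Pi\<^sub>M UNIV (\<lambda>_::'i. borel::'b measure)"
  \<comment> \<open>Here \<open>undefined\<close> serves as an arbitrary fixed point; any other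
    value would do.\<close>
  define Z where "Z f i = (if i \<in> I then f i else (undefined :: 'b))" for f i
  have Z: "Z \<in> ?N \<rightarrow>\<^sub>M ?N"
    using measurable_PiM_single'[of UNIV "\<lambda>i f. Z f i" ?N "\<lambda>_. borel"]
    by (auto simp: Z_def[abs_def] PiE_def)
  have law: "emeasure (distr (Pi\<^sub>M UNIV K) ?N Z) C = emeasure (Pi\<^sub>M UNIV K) (Z -` C)"
    if K: "\<And>i. sets (K i) = sets borel" and C: "C \<in> sets ?N" for K C
  proof -
    have N: "sets (Pi\<^sub>M UNIV K) = sets ?N"
      by (rule sets_PiM_cong) (auto simp: K)
    then show ?thesis
      using Z C sets_eq_imp_space_eq[OF N]
      by (subst emeasure_distr) (auto simp: measurable_cong_sets[OF N refl] space_PiM)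
  qed
  have cyl: "emeasure (distr (Pi\<^sub>M UNIV K) ?N Z) {f. \<forall>i\<in>J. f i \<in> A i}
      = (\<Prod>i\<in>J. if i \<in> I then emeasure (K i) (A i) else indicator (A i) undefined)"
    if K: "\<And>i. prob_space (K i)" "\<And>i. sets (K i) = sets borel"
      and J: "finite J" and A: "\<And>i. i \<in> J \<Longrightarrow> A i \<in> sets borel" for K :: "'i \<Rightarrow> 'b measure" and J A
  proof -
    \<comment> \<open>Outside \<open>I\<close> the condition concerns the constant alone: it is
      either vacuous or impossible, so its factor is the mass of \<open>UNIV\<close> or of
      \<open>{}\<close>, that is, 1 or 0.\<close>
    let ?A = "\<lambda>i. if i \<in> I then A i else if undefined \<in> A i then UNIV else {}"
    have sp: "space (K i) = UNIV" for i
      using sets_eq_imp_space_eq[OF K(2)[of i]] by simp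
    have "Z -` {f. \<forall>i\<in>J. f i \<in> A i} = {f. \<forall>i\<in>J. f i \<in> ?A i}"
      by (auto simp: Z_def split: if_splits)
    moreover have "{f. \<forall>i\<in>J. f i \<in> A i} \<in> sets ?N"
      using J A by (intro cylinder_measurable) auto
    ultimately have "emeasure (distr (Pi\<^sub>M UNIV K) ?N Z) {f. \<forall>i\<in>J. f i \<in> A i}
        = emeasure (Pi\<^sub>M UNIV K) {f. \<forall>i\<in>J. f i \<in> ?A i}"
      by (simp add: law[OF K(2)])
    also have "\<dots> = (\<Prod>i\<in>J. emeasure (K i) (?A i))"
      using J A by (intro emeasure_PiM_cylinder) (auto simp: K sp)
    also have "\<dots> = (\<Prod>i\<in>J. if i \<in> I then emeasure (K i) (A i) else indicator (A i) undefined)"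
      using prob_space.emeasure_space_1[OF K(1)] by (intro prod.cong) (auto simp: sp)
    finally show ?thesis .
  qed
  have "distr (Pi\<^sub>M UNIV K) ?N Z = distr (Pi\<^sub>M UNIV L) ?N Z"
  proof (rule measure_eqI_cylinder[where M="\<lambda>_. borel"])
    have N: "sets (Pi\<^sub>M UNIV K) = sets ?N"
      by (rule sets_PiM_cong) (auto simp: K)
    show "finite_measure (distr (Pi\<^sub>M UNIV K) ?N Z)"
      using Z by (intro prob_space.finite_measure prob_space.prob_space_distr prob_space_PiM K)
        (simp add: measurable_cong_sets[OF N refl])
  qed (auto simp: cyl K L eq intro!: prod.cong)
  \<comment> \<open>\<open>Z f\<close> and \<open>f\<close> agree on \<open>I\<close>, so saturation
    applies.\<close>
  moreover have "Z -` B = B"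
    using sat[of "Z _"] by (auto simp: Z_def)
  ultimately show ?thesis
    using law[of K, OF K(2) B] law[of L, OF L(2) B] by simp
qed

section \<open>Transfer to the Hilbert space\<close>

theorem theorem3p4:
  fixes M :: "'w measure"
    and r :: "nat \<Rightarrow> 'a::{real_inner, banach, second_countable_topology}"
    and \<gamma> :: "nat \<Rightarrow> real"
    and \<xi> :: "nat \<Rightarrow> 'w \<Rightarrow> real"
    and \<mu>s :: "nat \<Rightarrow> real measure"
    and \<mu> :: "'a measure"
    and Qs :: "nat \<Rightarrow> real \<Rightarrow> real measure"
  assumes "orthonormal_basis r"
    and "prob_space M"
    and "prob_space.indep_vars M (\<lambda>_. borel) \<xi> UNIV"
    and "\<And>k. distr M borel (\<xi> k) = \<mu>s k"
    and "AE \<omega> in M. summable (series_term \<gamma> r (\<lambda>j. \<xi> j \<omega>))"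
    and "\<mu> = distr M borel (\<lambda>\<omega>. \<Sum>k. series_term \<gamma> r (\<lambda>j. \<xi> j \<omega>) k)"
    and "\<And>k. prob_kernel (Qs k)"
    and "\<And>k. detailed_balance (\<mu>s k) (Qs k)"
  shows "prob_kernel (product_kernel \<gamma> r Qs)
       \<and> (AE u in \<mu>. AE \<zeta> in draw_law \<gamma> r Qs u. summable (series_term \<gamma> r \<zeta>))
       \<and> detailed_balance \<mu> (product_kernel \<gamma> r Qs)"
proof -
  interpret prob_space M by fact
  note Q = \<open>\<And>k. prob_kernel (Qs k)\<close>
  let ?N = "Pi\<^sub>M UNIV (\<lambda>_::nat. borel :: real measure)"
  define T where "T c = (\<Pi>\<^sub>M k\<in>UNIV. Qs k (c k))" for c
  define S where "S c = (\<Sum>k. series_term \<gamma> r c k)" for c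
  define P where "P = distr M ?N (\<lambda>\<omega> k. \<xi> k \<omega>)"
  define D where "D = {c. summable (series_term \<gamma> r c)}"
  have meas: "random_variable borel (\<xi> k)" for k
    using assms(3) by (auto simp: indep_vars_def)
  have XN [measurable]: "(\<lambda>\<omega> k. \<xi> k \<omega>) \<in> M \<rightarrow>\<^sub>M ?N"
    using measurable_PiM_single'[of UNIV \<xi> M "\<lambda>_. borel"] meas by (simp add: PiE_def)
  have sets_P [measurable_cong]: "sets P = sets ?N" and space_P: "space P = UNIV"
    by (simp_all add: P_def space_PiM)
  have [measurable]: "(\<lambda>c. series_term \<gamma> r c k) \<in> borel_measurable ?N" for k
    unfolding series_term_def by measurable
  have S [measurable]: "S \<in> ?N \<rightarrow>\<^sub>M borel"
    unfolding S_def by measurable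
  have D [measurable]: "D \<in> sets ?N"
  proof -
    \<comment> \<open>Completeness of the space turns convergence into the Cauchy property, which is
      a countable condition on the partial sums.\<close>
    have "{c \<in> space ?N. Cauchy (\<lambda>n. \<Sum>k<n. series_term \<gamma> r c k)} \<in> sets ?N"
      by measurable
    then show ?thesis
      by (simp add: D_def summable_iff_convergent Cauchy_convergent_iff space_PiM)
  qed
  have \<mu>: "\<mu> = distr P borel S"
    unfolding assms(6) P_def S_def[symmetric] by (subst distr_distr) (auto simp: comp_def)
  have PD: "AE c in P. c \<in> D"
    unfolding P_def using assms(5) D
    by (subst AE_distr_iff) (auto simp: D_def space_PiM)
  have T: "T \<in> ?N \<rightarrow>\<^sub>M prob_algebra ?N"
    unfolding T_def using Q by (rule measurable_PiM_kernel)
  have prob_T: "prob_space (T c)" and sets_T: "sets (T c) = sets ?N" and space_T: "space (T c) = UNIV" for c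
    using measurable_space[OF T, of c] sets_eq_imp_space_eq[of "T c" ?N]
    by (auto simp: space_prob_algebra space_PiM)
  have Tm [measurable]: "(\<lambda>c. emeasure (T c) C) \<in> borel_measurable ?N" if "C \<in> sets ?N" for C
    by (rule measurable_emeasure_kernel[OF measurable_prob_algebraD[OF T] that])
  have coeff [measurable]: "coefficient \<gamma> r \<in> borel \<rightarrow>\<^sub>M ?N"
    using measurable_PiM_single'[of UNIV "\<lambda>k u. coefficient \<gamma> r u k" borel "\<lambda>_. borel"]
    by (auto simp: coefficient_def[abs_def] PiE_def)
  have draw: "draw_law \<gamma> r Qs u = T (coefficient \<gamma> r u)" for u
    by (simp add: draw_law_def T_def)
  \<comment> \<open>The kernel is a composition: read off the coefficients, draw with
    \<open>T\<close>, sum with \<open>S\<close>. Its measurability follows from that of the three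
    stages.\<close>
  have pk: "product_kernel \<gamma> r Qs u = distr (T (coefficient \<gamma> r u)) borel S" for u
    by (simp add: product_kernel_def draw S_def[abs_def])
  have kernel: "prob_kernel (product_kernel \<gamma> r Qs)"
    unfolding prob_kernel_def pk
    by (rule measurable_compose[OF measurable_compose[OF coeff T] measurable_distr_prob_space[OF S]])
  have balance: "(\<integral>\<^sup>+c\<in>A. emeasure (T c) B \<partial>P) = (\<integral>\<^sup>+c\<in>B. emeasure (T c) A \<partial>P)"
    if "A \<in> sets ?N" "B \<in> sets ?N" for A B
    unfolding T_def P_def using assms that by (intro PiM_kernel_balance) auto
  text \<open>The kernels drawn from \<open>c\<close> and from the coefficients of \<open>S c\<close> agree wherever
    \<open>\<gamma> k \<noteq> 0\<close>, and the remaining coordinates are invisible to \<open>S\<close>.\<close>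
  have recover: "emeasure (T (coefficient \<gamma> r (S c))) B = emeasure (T c) B"
    if c: "c \<in> D" and B: "B \<in> sets ?N"
      and sat: "\<And>f g. series_term \<gamma> r f = series_term \<gamma> r g \<Longrightarrow> f \<in> B \<longleftrightarrow> g \<in> B" for c B
    unfolding T_def
  proof (rule emeasure_PiM_saturated_cong[where I="{k. \<gamma> k \<noteq> 0}"])
    fix k assume "k \<in> {k. \<gamma> k \<noteq> 0}"
    moreover have "series_term \<gamma> r c sums S c"
      using c unfolding D_def S_def by (simp add: summable_sums)
    ultimately show "Qs k (coefficient \<gamma> r (S c) k) = Qs k (c k)"
      using coefficient_unique[OF assms(1)] by simp
  next
    fix f g :: "nat \<Rightarrow> real" assume "\<And>i. i \<in> {k. \<gamma> k \<noteq> 0} \<Longrightarrow> f i = g i"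
    then have "series_term \<gamma> r f = series_term \<gamma> r g"
      by (auto simp: series_term_def fun_eq_iff)
    then show "f \<in> B \<longleftrightarrow> g \<in> B" by (rule sat)
  qed (use B in \<open>auto simp: prob_kernelD[OF Q]\<close>)
  have ND: "- D \<in> sets ?N"
    using sets.compl_sets[OF D] by (simp add: space_PiM Compl_eq_Diff_UNIV)
  \<comment> \<open>Balance for the pair \<open>UNIV\<close>, \<open>- D\<close>: the mean
    probability of drawing a divergent series equals the \<open>P\<close>-mass of
    \<open>- D\<close>, which is null.\<close>
  have "(\<integral>\<^sup>+c. emeasure (T c) (- D) \<partial>P) = (\<integral>\<^sup>+c\<in>- D. emeasure (T c) UNIV \<partial>P)"
    using balance[of UNIV "- D"] ND sets.top[of ?N] by (simp add: space_PiM)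
  also have "\<dots> = (\<integral>\<^sup>+c. 0 \<partial>P)"
    using PD by (intro nn_integral_cong_AE) auto
  finally have "(\<integral>\<^sup>+c. emeasure (T c) (- D) \<partial>P) = 0"
    by simp
  then have "AE c in P. emeasure (T c) (- D) = 0"
    using Tm[OF ND] by (subst (asm) nn_integral_0_iff_AE) (auto simp: measurable_cong_sets[OF sets_P refl])
  \<comment> \<open>Convergence depends only on the terms of the series, so \<open>- D\<close> is a
    set to which \<open>recover\<close> applies; this replaces \<open>c\<close> by a function of
    \<open>S c\<close>, as the passage to \<open>\<mu>\<close> demands.\<close>
  then have "AE c in P. emeasure (T (coefficient \<gamma> r (S c))) (- D) = 0"
    using PD by eventually_elim (subst recover, auto simp: ND, auto simp: D_def)
  then have "AE u in \<mu>. emeasure (T (coefficient \<gamma> r u)) (- D) = 0"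
    unfolding \<mu> using ND by (subst AE_distr_iff) (auto simp: measurable_cong_sets[OF sets_P refl])
  then have summ: "AE u in \<mu>. AE \<zeta> in draw_law \<gamma> r Qs u. summable (series_term \<gamma> r \<zeta>)"
  proof eventually_elim
    case (elim u)
    then show ?case
      unfolding draw using ND by (intro AE_I[where N="- D"]) (auto simp: D_def sets_T)
  qed
  have "detailed_balance \<mu> (product_kernel \<gamma> r Qs)"
    unfolding detailed_balance_def
  proof (intro ballI)
    have vim: "S -` C \<in> sets ?N" if "C \<in> sets borel" for C
      using measurable_sets[OF S that] by (simp add: space_PiM)
    \<comment> \<open>Both the start and the draw are pulled back along \<open>S\<close>, which
      reduces balance for \<open>A\<close> and \<open>B\<close> to \<open>balance\<close> for their
      preimages.\<close>
    have eq: "(\<integral>\<^sup>+u\<in>A. emeasure (product_kernel \<gamma> r Qs u) B \<partial>\<mu>) = (\<integral>\<^sup>+c\<in>S -` A. emeasure (T c) (S -` B) \<partial>P)"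
      if A: "A \<in> sets borel" and B: "B \<in> sets borel" for A B
    proof -
      have "emeasure (product_kernel \<gamma> r Qs u) B = emeasure (T (coefficient \<gamma> r u)) (S -` B)" for u
        unfolding pk using B by (subst emeasure_distr) (auto simp: measurable_cong_sets[OF sets_T refl] space_T)
      then have "(\<integral>\<^sup>+u\<in>A. emeasure (product_kernel \<gamma> r Qs u) B \<partial>\<mu>)
          = (\<integral>\<^sup>+c. emeasure (T (coefficient \<gamma> r (S c))) (S -` B) * indicator A (S c) \<partial>P)"
        unfolding \<mu> using A vim[OF B]
        by (simp, subst nn_integral_distr)
          (auto simp: measurable_cong_sets[OF sets_P refl] intro!: measurable_compose[OF coeff])
      \<comment> \<open>Membership in the preimage of \<open>B\<close> depends only on the terms of
        the series, so \<open>recover\<close> applies on \<open>D\<close>; the complement of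
        \<open>D\<close> is \<open>P\<close>-null.\<close>
      also have "\<dots> = (\<integral>\<^sup>+c\<in>S -` A. emeasure (T c) (S -` B) \<partial>P)"
        using PD by (intro nn_integral_cong_AE, eventually_elim)
          (subst recover, auto simp: vim[OF B] indicator_def, auto simp: S_def)
      finally show ?thesis .
    qed
    show "(\<integral>\<^sup>+u\<in>A. emeasure (product_kernel \<gamma> r Qs u) B \<partial>\<mu>) = (\<integral>\<^sup>+u\<in>B. emeasure (product_kernel \<gamma> r Qs u) A \<partial>\<mu>)"
      if "A \<in> sets borel" "B \<in> sets borel" for A B
      using that by (simp add: eq balance vim)
  qed
  with kernel summ show ?thesis by blast
qed

end
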